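(* Let $0<p<1$ and $\alpha>0$ be real numbers, and let $X$ be a discrete random variable with support $\{0,1,2,\ldots\}$. Then $X$ follows the skewed geometric distribution $SG(p,\alpha)$ if and only if for every integer $k\ge 0$ $$E\left[\frac{p^X(1+p)(1-p^{\alpha+1})-p^{X(\alpha+1)+1}(1-p)(1+p^{\alpha+1})}{1-p+p^2-p^{\alpha+1}}\;\middle|\;X\ge k\right]=\frac{p^k\left(1-p^{\alpha+1}-p^{\alpha k+1}+p^{\alpha k+2}\right)}{1-p+p^2-p^{\alpha+1}}.$$
   Context: For $0<p<1$ and $\alpha>0$, the skewed geometric distribution $SG(p,\alpha)$ is the probability distribution on $\{0,1,2,\ldots\}$ with probability mass function $P_X(x)=\dfrac{(1-p)p^x(1-p^{\alpha x+1})(1-p^{\alpha+1})}{1-p^{\alpha+1}-p(1-p)}$. "Support $\{0,1,2,\ldots\}$" means that $X$ takes values in $\{0,1,2,\ldots\}$ and $P(X=x)>0$ for every $x\in\{0,1,2,\ldots\}$. *)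

theory Defs
  imports "HOL-Probability.Probability"
begin

definition sg_mass :: "real \<Rightarrow> real \<Rightarrow> nat \<Rightarrow> real" where
  "sg_mass p \<alpha> x =
     (1 - p) * p ^ x * (1 - p powr (\<alpha> * real x + 1)) * (1 - p powr (\<alpha> + 1))
       / (1 - p powr (\<alpha> + 1) - p * (1 - p))"

definition follows_sg :: "'a measure \<Rightarrow> ('a \<Rightarrow> nat) \<Rightarrow> real \<Rightarrow> real \<Rightarrow> bool" where
  "follows_sg M X p \<alpha> \<longleftrightarrow>
     distributed M (count_space UNIV) X (\<lambda>x. ennreal (sg_mass p \<alpha> x))"

text \<open>Elementary conditional expectation \<open>E[Y | A]\<close> given an event \<open>A\<close> of positive probability:
  the expectation of \<open>Y\<close> under the conditional probability measure \<open>P(\<sqdot> | A)\<close>,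
  which is \<open>uniform_measure M A\<close>.\<close>
definition event_cond_exp :: "'a measure \<Rightarrow> 'a set \<Rightarrow> ('a \<Rightarrow> real) \<Rightarrow> real" where
  "event_cond_exp M A Y = integral\<^sup>L (uniform_measure M A) Y"

lemma sg_aux:
  fixes p \<alpha> :: real
  assumes "0 < p" "p < 1" "0 < \<alpha>"
  shows "p powr (\<alpha> + 1) < 1" and "0 < 1 - p powr (\<alpha> + 1) - p * (1 - p)"
proof -
  have a: "p powr (\<alpha> + 1) < p powr 1"
    using assms by (intro powr_less_mono') auto
  with assms show "p powr (\<alpha> + 1) < 1" by simp
  have "0 < (1 - p) * (1 - p)" using assms by simp
  with a assms show "0 < 1 - p powr (\<alpha> + 1) - p * (1 - p)" by (simp add: algebra_simps)
qed

lemma sg_mass_pos: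
  assumes "0 < p" "p < 1" "0 < \<alpha>"
  shows "0 < sg_mass p \<alpha> x"
proof -
  have "p powr (\<alpha> * real x + 1) < p powr 0"
    using assms by (intro powr_less_mono') (auto simp: add_nonneg_pos)
  then show ?thesis
    using sg_aux[OF assms] assms by (auto simp: sg_mass_def)
qed

lemma sg_mass_sums:
  assumes "0 < p" "p < 1" "0 < \<alpha>"
  shows "sg_mass p \<alpha> sums 1"
proof -
  define q where "q = p powr (\<alpha> + 1)"
  define D where "D = 1 - q - p * (1 - p)"
  have q: "0 < q" "q < 1" "0 < D"
    using sg_aux[OF assms] assms by (auto simp: q_def D_def)
  have pw: "p ^ x * p powr (\<alpha> * real x + 1) = p * q ^ x" for x
  proof -
    have "p ^ x * p powr (\<alpha> * real x + 1) = p powr (real x + (\<alpha> * real x + 1))"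
      using assms by (simp add: powr_add powr_realpow)
    also have "real x + (\<alpha> * real x + 1) = 1 + (\<alpha> + 1) * real x"
      by (simp add: algebra_simps)
    also have "p powr (1 + (\<alpha> + 1) * real x) = p * q powr real x"
      using assms by (subst powr_add) (simp add: q_def powr_powr)
    finally show ?thesis using q by (simp add: powr_realpow)
  qed
  have eq: "sg_mass p \<alpha> x = (1 - p) * (1 - q) / D * (p ^ x - p * q ^ x)" for x
    unfolding sg_mass_def q_def[symmetric] D_def[symmetric] pw[of x, symmetric]
    by (simp add: algebra_simps add_divide_distrib diff_divide_distrib)
  have "(\<lambda>x. (1 - p) * (1 - q) / D * (p ^ x - p * q ^ x)) sums
          ((1 - p) * (1 - q) / D * (1 / (1 - p) - p * (1 / (1 - q))))"
    using assms q by (intro sums_mult sums_diff geometric_sums) auto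
  also have "(1 - p) * (1 - q) / D * (1 / (1 - p) - p * (1 / (1 - q))) = D / D"
  proof -
    have "a * b * (1 / a - p * (1 / b)) = b - p * a" if "a \<noteq> 0" "b \<noteq> 0" for a b :: real
      using that by (simp add: field_simps)
    from this[of "1 - p" "1 - q"]
    have "(1 - p) * (1 - q) * (1 / (1 - p) - p * (1 / (1 - q))) = D"
      using assms q by (simp add: D_def)
    then show ?thesis by (metis times_divide_eq_left)
  qed
  finally show ?thesis using q by (simp add: eq[abs_def])
qed

lemma event_cond_exp_eq:
  assumes "prob_space M" "A \<in> sets M" "Y \<in> borel_measurable M" "measure M A > 0"
  shows "event_cond_exp M A Y = integral\<^sup>L M (\<lambda>\<omega>. indicator A \<omega> * Y \<omega>) / measure M A"
proof -
  interpret prob_space M by fact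
  have "uniform_measure M A = density M (\<lambda>\<omega>. ennreal (indicator A \<omega> / measure M A))"
    unfolding uniform_measure_def
    by (rule arg_cong[where f = "density M"], rule ext)
       (use assms in \<open>auto simp: emeasure_eq_measure indicator_def divide_ennreal
          simp flip: ennreal_1\<close>)
  then show ?thesis
    using assms unfolding event_cond_exp_def
    by (simp add: integral_density field_simps flip: integral_divide_zero)
qed

end

theory Submission imports Defs begin

text \<open>With \<open>q = p powr (\<alpha> + 1)\<close> and \<open>D = 1 - p + p\<^sup>2 - q\<close>, the survival function of \<open>SG(p, \<alpha>)\<close> is
  \<open>g k = (p ^ k * (1 - q) - p * (1 - p) * q ^ k) / D\<close>. This is exactly the right-hand side of the
  characterization, and the conditioned function is \<open>h x = g x + g (x + 1)\<close>. If \<open>P(X = x) = g x - g (x + 1)\<close>,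
  then \<open>h x * P(X = x)\<close> telescopes to \<open>(g k)\<^sup>2\<close> over \<open>x \<ge> k\<close>.
  Conversely, subtracting the conditions \<open>E[h(X); X \<ge> k] = g k * P(X \<ge> k)\<close> for \<open>k\<close> and \<open>k + 1\<close>
  leaves \<open>g (k + 1) * P(X \<ge> k) = g k * P(X \<ge> k + 1)\<close>, which determines the tails of \<open>X\<close>.\<close>

text \<open>Measures on a countable discrete space are determined by their values on singletons, and
  \<open>ennreal\<close> is injective on nonnegative reals, so equality of laws reduces to equality
  of real point masses.\<close>

lemma distributed_count_space_nat_iff:
  fixes X :: "'a \<Rightarrow> nat" and f :: "nat \<Rightarrow> real"
  assumes "prob_space M" and X: "X \<in> measurable M (count_space UNIV)" and f: "\<And>x. 0 \<le> f x"
  shows "distributed M (count_space UNIV) X (\<lambda>x. ennreal (f x)) \<longleftrightarrow>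
    (\<forall>x. measure M {\<omega> \<in> space M. X \<omega> = x} = f x)"
proof -
  interpret prob_space M by fact
  let ?d = "distr M (count_space UNIV) X" and ?e = "density (count_space UNIV) (\<lambda>x. ennreal (f x))"
  have d: "emeasure ?d {x} = ennreal (measure M {\<omega> \<in> space M. X \<omega> = x})" for x
    using X by (subst emeasure_distr)
      (auto simp: emeasure_eq_measure intro!: arg_cong[where f = "measure M"])
  have e: "emeasure ?e {x} = ennreal (f x)" for x
    by (subst emeasure_density) (auto simp: nn_integral_count_space_indicator[symmetric])
  have "?d = ?e \<longleftrightarrow> (\<forall>x. emeasure ?d {x} = emeasure ?e {x})"
  proof
    assume "\<forall>x. emeasure ?d {x} = emeasure ?e {x}"
    then show "?d = ?e"
      by (intro measure_eqI_countable[where A = UNIV]) auto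
  qed simp
  then show ?thesis
    using X f by (simp add: distributed_def d e)
qed

lemma prob_ge_split:
  fixes X :: "'a \<Rightarrow> nat"
  assumes "prob_space M" and X[measurable]: "X \<in> measurable M (count_space UNIV)"
  shows "measure M {\<omega> \<in> space M. X \<omega> \<ge> k} =
    measure M {\<omega> \<in> space M. X \<omega> = k} + measure M {\<omega> \<in> space M. X \<omega> \<ge> Suc k}"
proof -
  interpret prob_space M by fact
  have "{\<omega> \<in> space M. X \<omega> \<ge> k} = {\<omega> \<in> space M. X \<omega> = k} \<union> {\<omega> \<in> space M. X \<omega> \<ge> Suc k}"
    by auto
  then show ?thesis
    by (simp only:) (rule finite_measure_Union, auto)
qed

text \<open>Peeling off the atom \<open>X = k\<close> gives the recursion behind the telescoping.
  The bound makes the tail expectations vanish with the tail probabilities, which later fixes the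
  constant that telescoping leaves open.\<close>

lemma expectation_ge_split:
  fixes X :: "'a \<Rightarrow> nat" and h :: "nat \<Rightarrow> real"
  assumes "prob_space M" and X[measurable]: "X \<in> measurable M (count_space UNIV)"
    and h: "\<And>x. \<bar>h x\<bar> \<le> B"
  defines "a \<equiv> \<lambda>k. integral\<^sup>L M (\<lambda>\<omega>. indicator {\<omega> \<in> space M. X \<omega> \<ge> k} \<omega> * h (X \<omega>))"
  shows "a k = h k * measure M {\<omega> \<in> space M. X \<omega> = k} + a (Suc k)"
    and "\<bar>a k\<bar> \<le> B * measure M {\<omega> \<in> space M. X \<omega> \<ge> k}"
proof -
  interpret prob_space M by fact
  have B: "0 \<le> B" using h[of 0] by simp
  have int: "integrable M (\<lambda>\<omega>. indicator {\<omega> \<in> space M. X \<omega> \<ge> k} \<omega> * h (X \<omega>))" for k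
    by (rule integrable_const_bound[where B = B])
       (use h B in \<open>auto simp: indicator_def\<close>)
  have "a k = integral\<^sup>L M (\<lambda>\<omega>. indicator {\<omega> \<in> space M. X \<omega> = k} \<omega> * h k
      + indicator {\<omega> \<in> space M. X \<omega> \<ge> Suc k} \<omega> * h (X \<omega>))"
    unfolding a_def
    by (rule Bochner_Integration.integral_cong) (auto simp: indicator_def not_less_eq_eq intro: arg_cong[where f = h])
  also have "\<dots> = integral\<^sup>L M (\<lambda>\<omega>. indicator {\<omega> \<in> space M. X \<omega> = k} \<omega> * h k) + a (Suc k)"
    unfolding a_def
    by (rule Bochner_Integration.integral_add[OF _ int]) (simp add: emeasure_eq_measure)
  also have "integral\<^sup>L M (\<lambda>\<omega>. indicator {\<omega> \<in> space M. X \<omega> = k} \<omega> * h k)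
      = h k * measure M {\<omega> \<in> space M. X \<omega> = k}"
    by simp
  finally show "a k = h k * measure M {\<omega> \<in> space M. X \<omega> = k} + a (Suc k)" .
  have "\<bar>a k\<bar> \<le> integral\<^sup>L M (\<lambda>\<omega>. \<bar>indicator {\<omega> \<in> space M. X \<omega> \<ge> k} \<omega> * h (X \<omega>)\<bar>)"
    unfolding a_def by (rule integral_abs_bound)
  also have "\<dots> \<le> integral\<^sup>L M (\<lambda>\<omega>. B * indicator {\<omega> \<in> space M. X \<omega> \<ge> k} \<omega>)"
  proof (rule integral_mono)
    show "integrable M (\<lambda>\<omega>. B * indicator {\<omega> \<in> space M. X \<omega> \<ge> k} \<omega>)"
      by (simp add: emeasure_eq_measure)
    show "integrable M (\<lambda>\<omega>. \<bar>indicator {\<omega> \<in> space M. X \<omega> \<ge> k} \<omega> * h (X \<omega>)\<bar>)"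
      by (rule integrable_abs[OF int])
  qed (use h in \<open>auto simp: indicator_def\<close>)
  finally show "\<bar>a k\<bar> \<le> B * measure M {\<omega> \<in> space M. X \<omega> \<ge> k}"
    by simp
qed

text \<open>The argument is independent of the particular formula for \<open>g\<close>: the value at
  0 starts the inductions, positivity permits cancellation in the converse, and the limit 0 removes
  the telescoping constant.\<close>

lemma survival_characterization:
  fixes X :: "'a \<Rightarrow> nat" and g :: "nat \<Rightarrow> real"
  assumes M: "prob_space M" and X[measurable]: "X \<in> measurable M (count_space UNIV)"
    and pos: "\<And>k. measure M {\<omega> \<in> space M. X \<omega> \<ge> k} > 0"
    and g: "g 0 = 1" "\<And>k. 0 < g k" "g \<longlonglongrightarrow> 0"
  shows "(\<forall>k. measure M {\<omega> \<in> space M. X \<omega> = k} = g k - g (Suc k)) \<longleftrightarrow>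
    (\<forall>k. event_cond_exp M {\<omega> \<in> space M. X \<omega> \<ge> k} (\<lambda>\<omega>. g (X \<omega>) + g (Suc (X \<omega>))) = g k)"
proof -
  interpret prob_space M by fact
  define f where "f k = measure M {\<omega> \<in> space M. X \<omega> = k}" for k
  define S where "S k = measure M {\<omega> \<in> space M. X \<omega> \<ge> k}" for k
  define h where "h k = g k + g (Suc k)" for k
  define a where "a k = integral\<^sup>L M (\<lambda>\<omega>. indicator {\<omega> \<in> space M. X \<omega> \<ge> k} \<omega> * h (X \<omega>))" for k
  obtain C where C: "\<And>k. norm (g k) \<le> C"
    using convergent_imp_Bseq[OF convergentI[OF g(3)]] by (auto simp: Bseq_def)
  have h_bound: "\<bar>h k\<bar> \<le> 2 * C" for k
    using C[of k] C[of "Suc k"] by (simp add: h_def abs_le_iff)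
  note a_split = expectation_ge_split[where h = h, OF M X h_bound, folded a_def f_def S_def]
  have S_split: "S k = f k + S (Suc k)" for k
    unfolding S_def f_def by (rule prob_ge_split[OF M X])
  have S_0: "S 0 = 1"
    by (simp add: S_def prob_space)
  have "event_cond_exp M {\<omega> \<in> space M. X \<omega> \<ge> k} (\<lambda>\<omega>. g (X \<omega>) + g (Suc (X \<omega>))) = a k / S k" for k
    unfolding a_def h_def S_def
    by (rule event_cond_exp_eq[OF M _ _ pos]) measurable
  \<comment> \<open>Since \<open>S k\<close> is positive, the conditional equation can be multiplied
    out.\<close>
  then have cond: "event_cond_exp M {\<omega> \<in> space M. X \<omega> \<ge> k} (\<lambda>\<omega>. g (X \<omega>) + g (Suc (X \<omega>))) = g k
      \<longleftrightarrow> a k = g k * S k" for k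
    using pos[of k] by (simp add: S_def[symmetric] field_simps)
  have "(\<forall>k. f k = g k - g (Suc k)) \<longleftrightarrow> (\<forall>k. a k = g k * S k)"
  proof
    assume f: "\<forall>k. f k = g k - g (Suc k)"
    have S: "S k = g k" for k
    proof (induction k)
      case (Suc k)
      then show ?case using S_split[of k] f by simp
    qed (simp add: S_0 g)
    \<comment> \<open>Here \<open>h k * f k\<close> is
      \<open>(g k + g (Suc k)) * (g k - g (Suc k))\<close>, a difference of squares.\<close>
    have step: "a k - (g k)\<^sup>2 = a (Suc k) - (g (Suc k))\<^sup>2" for k
      unfolding a_split(1)[of k] h_def f[rule_format] by (simp add: algebra_simps power2_eq_square)
    define c where "c = a 0 - (g 0)\<^sup>2"
    have const: "a k - (g k)\<^sup>2 = c" for k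
    proof (induction k)
      case (Suc k)
      then show ?case unfolding step[of k] .
    qed (simp add: c_def)
    \<comment> \<open>The bound on \<open>a k\<close> is \<open>2 * C * S k\<close>, and
      \<open>S\<close> is already known to equal \<open>g\<close>.\<close>
    have "(\<lambda>k. 2 * C * g k) \<longlonglongrightarrow> 2 * C * 0"
      by (intro tendsto_intros g)
    then have "a \<longlonglongrightarrow> 0"
      using a_split(2) by (intro Lim_null_comparison[where f = a and g = "\<lambda>k. 2 * C * g k"])
        (auto simp: S)
    then have "(\<lambda>k. a k - (g k)\<^sup>2) \<longlonglongrightarrow> 0 - 0\<^sup>2"
      by (intro tendsto_intros g)
    then have "c = 0"
      by (simp add: const LIMSEQ_const_iff)
    then show "\<forall>k. a k = g k * S k"
      using const by (simp add: S power2_eq_square)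
  next
    assume a: "\<forall>k. a k = g k * S k"
    \<comment> \<open>Replace \<open>a\<close> by \<open>g * S\<close> in the recursion and
      \<open>f k\<close> by \<open>S k - S (Suc k)\<close>; after expanding \<open>h k\<close>, only
      the two mixed products survive.\<close>
    have step: "g (Suc k) * S k = g k * S (Suc k)" for k
    proof -
      have "g k * S k = h k * (S k - S (Suc k)) + g (Suc k) * S (Suc k)"
        using a_split(1)[of k] a S_split[of k] by simp
      then show ?thesis by (simp add: h_def algebra_simps)
    qed
    have S: "S k = g k" for k
    proof (induction k)
      case (Suc k)
      then show ?case using step[of k] g(2)[of k] by simp
    qed (simp add: S_0 g)
    have "f k = g k - g (Suc k)" for k
      using S_split[of k] by (simp add: S)
    then show "\<forall>k. f k = g k - g (Suc k)" ..
  qed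
  then show ?thesis
    unfolding cond f_def .
qed

theorem theorem2:
  fixes p \<alpha> :: real and M :: "'a measure" and X :: "'a \<Rightarrow> nat"
  assumes "0 < p" "p < 1" "0 < \<alpha>"
    and "prob_space M"
    and "X \<in> measurable M (count_space UNIV)"
    and "\<forall>x. measure M {\<omega> \<in> space M. X \<omega> = x} > 0"
  shows "follows_sg M X p \<alpha> \<longleftrightarrow>
    (\<forall>k::nat.
      event_cond_exp M {\<omega> \<in> space M. X \<omega> \<ge> k}
        (\<lambda>\<omega>. (p ^ X \<omega> * (1 + p) * (1 - p powr (\<alpha> + 1))
               - p powr (real (X \<omega>) * (\<alpha> + 1) + 1) * (1 - p) * (1 + p powr (\<alpha> + 1)))
             / (1 - p + p\<^sup>2 - p powr (\<alpha> + 1)))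
      = p ^ k * (1 - p powr (\<alpha> + 1) - p powr (\<alpha> * real k + 1) + p powr (\<alpha> * real k + 2))
          / (1 - p + p\<^sup>2 - p powr (\<alpha> + 1)))"
proof -
  interpret prob_space M by fact
  note X[measurable] = assms(5)
  define q where "q = p powr (\<alpha> + 1)"
  define D where "D = 1 - p + p\<^sup>2 - q"
  define g where "g k = (p ^ k * (1 - q) - p * (1 - p) * q ^ k) / D" for k
  have q: "0 < q" "q < 1" "0 < D"
    using sg_aux[OF assms(1-3)] assms(1)
    by (auto simp: q_def D_def power2_eq_square algebra_simps)
  have "q < p powr 1"
    unfolding q_def using assms by (intro powr_less_mono') auto
  then have qp: "q \<le> p" using assms by simp
  \<comment> \<open>The real exponents combine with the factor \<open>p ^ x\<close> into powers of
    \<open>q\<close>, so the mass, the conditioned function and the right-hand side all become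
    linear combinations of \<open>p ^ x\<close> and \<open>q ^ x\<close>.\<close>
  have pw: "p powr (real x * (\<alpha> + 1) + 1) = p * q ^ x" for x
  proof -
    have "q ^ x = p powr (real x * (\<alpha> + 1))"
      unfolding powr_realpow[OF q(1), symmetric] by (simp add: q_def powr_powr mult.commute)
    then show ?thesis using assms by (simp add: powr_add)
  qed
  have pw1: "p ^ x * p powr (\<alpha> * real x + 1) = p * q ^ x" for x
    unfolding pw[symmetric] using assms
    by (simp add: algebra_simps flip: powr_realpow powr_add)
  have pw2: "p ^ x * p powr (\<alpha> * real x + 2) = p\<^sup>2 * q ^ x" for x
  proof -
    have "p powr (\<alpha> * real x + 2) = p * p powr (\<alpha> * real x + 1)"
      using assms by (simp add: powr_mult_base add.commute)
    then show ?thesis using pw1[of x] by (simp add: power2_eq_square ac_simps)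
  qed
  have mass: "sg_mass p \<alpha> k = g k - g (Suc k)" for k
  proof -
    have "sg_mass p \<alpha> k = (1 - p) * (1 - q) * (p ^ k - p ^ k * p powr (\<alpha> * real k + 1)) / D"
      by (simp add: sg_mass_def q_def D_def power2_eq_square algebra_simps)
    also have "\<dots> = g k - g (Suc k)"
      unfolding pw1 g_def diff_divide_distrib[symmetric]
      by (rule arg_cong[where f = "\<lambda>x. x / D"]) (simp add: algebra_simps)
    finally show ?thesis .
  qed
  have h: "(p ^ x * (1 + p) * (1 - q) - p powr (real x * (\<alpha> + 1) + 1) * (1 - p) * (1 + q)) / D
      = g x + g (Suc x)" for x
    unfolding pw g_def add_divide_distrib[symmetric]
    by (rule arg_cong[where f = "\<lambda>x. x / D"]) (simp add: algebra_simps)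
  have rhs: "p ^ k * (1 - q - p powr (\<alpha> * real k + 1) + p powr (\<alpha> * real k + 2)) / D = g k" for k
  proof -
    have "p ^ k * (1 - q - p powr (\<alpha> * real k + 1) + p powr (\<alpha> * real k + 2))
        = p ^ k * (1 - q) - p ^ k * p powr (\<alpha> * real k + 1) + p ^ k * p powr (\<alpha> * real k + 2)"
      by (simp add: algebra_simps)
    then show ?thesis
      unfolding pw1 pw2 g_def by (simp add: algebra_simps power2_eq_square)
  qed
  \<comment> \<open>At 0 the numerator is \<open>1 - q - p * (1 - p)\<close>, which is
    \<open>D\<close>.\<close>
  have "g 0 = 1"
    using q by (simp add: g_def D_def power2_eq_square algebra_simps)
  moreover have "0 < g k" for k
  proof -
    \<comment> \<open>Compare the two terms of the numerator factor by factor: \<open>q ^ k\<close>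
      is at most \<open>p ^ k\<close>, and \<open>1 - q\<close> exceeds \<open>p * (1 - p)\<close>
      by exactly \<open>D > 0\<close>.\<close>
    have "p * (1 - p) * q ^ k \<le> p * (1 - p) * p ^ k"
      using assms q qp by (intro mult_left_mono power_mono) auto
    also have "\<dots> < (1 - q) * p ^ k"
      using assms q by (intro mult_strict_right_mono)
        (auto simp: D_def power2_eq_square algebra_simps)
    finally show ?thesis using q by (simp add: g_def mult.commute)
  qed
  moreover have "g \<longlonglongrightarrow> 0"
  proof -
    have "g \<longlonglongrightarrow> (0 * (1 - q) - p * (1 - p) * 0) / D"
      unfolding g_def using assms q by (intro tendsto_intros LIMSEQ_power_zero) auto
    then show ?thesis by simp
  qed
  \<comment> \<open>Full support enters here: the tail contains the atom at \<open>k\<close>, so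
    every conditioning event has positive probability.\<close>
  moreover have "measure M {\<omega> \<in> space M. X \<omega> \<ge> k} > 0" for k
    using prob_ge_split[OF assms(4) X, of k] assms(6) by (simp add: add_pos_nonneg)
  ultimately show ?thesis
    unfolding follows_sg_def q_def[symmetric] D_def[symmetric] h rhs
    using survival_characterization[OF assms(4) X, of g]
      distributed_count_space_nat_iff[OF assms(4) X, of "sg_mass p \<alpha>"]
      sg_mass_pos[OF assms(1-3)]
    by (simp add: mass less_imp_le)
qed

end
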